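(* Let $n\ge 1$. The number of words for the Garside element $\Delta_n=\rho_n^{n+1}$ of $M_n$ is a little Schröder number, namely the number of Schröder trees with $n+1$ leaves.
   Context: For $n\ge 1$, $M_n$ is the monoid with presentation $\langle \rho_1,\dots,\rho_n \mid \rho_1\rho_n\rho_i=\rho_{i+1}\rho_n \text{ for all } 1\le i\le n-1\rangle$. A word for $x\in M_n$ is a finite sequence of letters in $\{\rho_1,\dots,\rho_n\}$ whose product in $M_n$ is $x$. A Schröder tree is a rooted plane tree in which each inner (non-leaf) vertex has at least two children (the tree consisting of a single leaf is allowed). The little Schröder numbers (OEIS A001003) $1,1,3,11,45,197,903,4279,20793,\dots$ count Schröder trees with $1,2,3,4,\dots$ leaves. *)

theory Defs
  imports "HOL-Algebra.Group"
begin

section \<open>Monoid presentations\<close>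

text \<open>The congruence on the free monoid \<open>lists A\<close> generated by a set \<open>R\<close> of relations
  between words over \<open>A\<close>.\<close>

inductive_set pres_cong :: "'a set \<Rightarrow> ('a list \<times> 'a list) set \<Rightarrow> ('a list \<times> 'a list) set"
  for A :: "'a set" and R :: "('a list \<times> 'a list) set" where
  rel: "(u, v) \<in> R \<Longrightarrow> u \<in> lists A \<Longrightarrow> v \<in> lists A \<Longrightarrow> (u, v) \<in> pres_cong A R"
| refl: "u \<in> lists A \<Longrightarrow> (u, u) \<in> pres_cong A R"
| sym: "(u, v) \<in> pres_cong A R \<Longrightarrow> (v, u) \<in> pres_cong A R"
| trans: "(u, v) \<in> pres_cong A R \<Longrightarrow> (v, w) \<in> pres_cong A R \<Longrightarrow> (u, w) \<in> pres_cong A R"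
| append: "(u, v) \<in> pres_cong A R \<Longrightarrow> (u', v') \<in> pres_cong A R
    \<Longrightarrow> (u @ u', v @ v') \<in> pres_cong A R"

definition pres_monoid :: "'a set \<Rightarrow> ('a list \<times> 'a list) set \<Rightarrow> 'a list set monoid" where
  "pres_monoid A R =
    \<lparr>carrier = lists A // pres_cong A R,
     mult = (\<lambda>X Y. \<Union>u\<in>X. \<Union>v\<in>Y. pres_cong A R `` {u @ v}),
     one = pres_cong A R `` {[]}\<rparr>"

definition pres_gen :: "'a set \<Rightarrow> ('a list \<times> 'a list) set \<Rightarrow> 'a \<Rightarrow> 'a list set" where
  "pres_gen A R a = pres_cong A R `` {[a]}"

definition list_prod :: "('b, 'c) monoid_scheme \<Rightarrow> 'b list \<Rightarrow> 'b" where
  "list_prod G xs = foldr (mult G) xs \<one>\<^bsub>G\<^esub>"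

lemma pres_cong_lists: "(u, v) \<in> pres_cong A R \<Longrightarrow> u \<in> lists A \<and> v \<in> lists A"
  by (induction rule: pres_cong.induct) auto

lemma equiv_pres_cong: "equiv (lists A) (pres_cong A R)"
proof (rule equivI)
  show "pres_cong A R \<subseteq> lists A \<times> lists A"
    using pres_cong_lists by fast
  show "refl_on (lists A) (pres_cong A R)"
    by (rule refl_onI) (rule pres_cong.refl)
  show "Relation.sym (pres_cong A R)"
    by (rule symI) (rule pres_cong.sym)
  show "Relation.trans (pres_cong A R)"
    by (rule transI) (rule pres_cong.trans)
qed

lemma pres_mult_class:
  assumes "u \<in> lists A" "v \<in> lists A"
  shows "(pres_cong A R `` {u}) \<otimes>\<^bsub>pres_monoid A R\<^esub> (pres_cong A R `` {v})
    = pres_cong A R `` {u @ v}"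
proof -
  let ?cl = "\<lambda>w. pres_cong A R `` {w}"
  have cong: "?cl (u' @ v') = ?cl (u @ v)" if "u' \<in> ?cl u" "v' \<in> ?cl v" for u' v'
  proof -
    have "(u @ v, u' @ v') \<in> pres_cong A R"
      using that by (intro pres_cong.append) simp_all
    then show ?thesis
      by (rule equiv_class_eq[OF equiv_pres_cong, symmetric])
  qed
  have ne: "u \<in> ?cl u" "v \<in> ?cl v"
    using assms by (simp_all add: pres_cong.refl)
  have "(\<Union>u'\<in>?cl u. \<Union>v'\<in>?cl v. ?cl (u' @ v')) = (\<Union>u'\<in>?cl u. \<Union>v'\<in>?cl v. ?cl (u @ v))"
    by (intro SUP_cong HOL.refl cong)
  also have "\<dots> = ?cl (u @ v)"
    using ne by auto
  finally show ?thesis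
    by (simp only: pres_monoid_def monoid.simps)
qed

lemma monoid_pres_monoid: "monoid (pres_monoid A R)"
proof -
  have carr: "carrier (pres_monoid A R) = lists A // pres_cong A R"
    and one: "\<one>\<^bsub>pres_monoid A R\<^esub> = pres_cong A R `` {[]}"
    by (simp_all add: pres_monoid_def)
  show ?thesis
  proof (rule monoidI)
    fix x y z
    assume "x \<in> carrier (pres_monoid A R)" "y \<in> carrier (pres_monoid A R)"
      "z \<in> carrier (pres_monoid A R)"
    then obtain u v w where uvw: "u \<in> lists A" "v \<in> lists A" "w \<in> lists A"
      "x = pres_cong A R `` {u}" "y = pres_cong A R `` {v}" "z = pres_cong A R `` {w}"
      unfolding carr by (auto elim!: quotientE)
    have app: "u @ v \<in> lists A" "v @ w \<in> lists A"
      using uvw by auto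
    show "(x \<otimes>\<^bsub>pres_monoid A R\<^esub> y) \<otimes>\<^bsub>pres_monoid A R\<^esub> z
      = x \<otimes>\<^bsub>pres_monoid A R\<^esub> (y \<otimes>\<^bsub>pres_monoid A R\<^esub> z)"
      using uvw app by (simp only: pres_mult_class append_assoc)
  next
    fix x y
    assume "x \<in> carrier (pres_monoid A R)" "y \<in> carrier (pres_monoid A R)"
    then obtain u v where uv: "u \<in> lists A" "v \<in> lists A"
      "x = pres_cong A R `` {u}" "y = pres_cong A R `` {v}"
      unfolding carr by (auto elim!: quotientE)
    then have "x \<otimes>\<^bsub>pres_monoid A R\<^esub> y = pres_cong A R `` {u @ v}"
      by (simp only: pres_mult_class)
    moreover have "u @ v \<in> lists A"
      using uv by auto
    ultimately show "x \<otimes>\<^bsub>pres_monoid A R\<^esub> y \<in> carrier (pres_monoid A R)"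
      unfolding carr by (simp add: quotientI)
  next
    show "\<one>\<^bsub>pres_monoid A R\<^esub> \<in> carrier (pres_monoid A R)"
      unfolding carr one by (rule quotientI) simp
  next
    fix x
    assume "x \<in> carrier (pres_monoid A R)"
    then obtain u where u: "u \<in> lists A" "x = pres_cong A R `` {u}"
      unfolding carr by (auto elim!: quotientE)
    have nil: "[] \<in> lists A"
      by simp
    show "\<one>\<^bsub>pres_monoid A R\<^esub> \<otimes>\<^bsub>pres_monoid A R\<^esub> x = x"
      unfolding one u(2) by (simp only: pres_mult_class[OF nil u(1)] append_Nil)
    show "x \<otimes>\<^bsub>pres_monoid A R\<^esub> \<one>\<^bsub>pres_monoid A R\<^esub> = x"
      unfolding one u(2) by (simp only: pres_mult_class[OF u(1) nil] append_Nil2)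
  qed
qed

lemma list_prod_pres_gen:
  assumes "w \<in> lists A"
  shows "list_prod (pres_monoid A R) (map (pres_gen A R) w) = pres_cong A R `` {w}"
  using assms
proof (induction w rule: list.induct)
  case Nil
  show ?case
    by (simp add: list_prod_def pres_monoid_def)
next
  case (Cons a w)
  then have "[a] \<in> lists A" "w \<in> lists A"
    by auto
  from pres_mult_class[OF this, of R] Cons.IH[OF this(2)] show ?case
    by (simp add: list_prod_def pres_gen_def)
qed


section \<open>The monoid \<open>M\<^sub>n\<close>\<close>

text \<open>The generator \<open>\<rho>\<^sub>i\<close> is represented by the letter \<open>i\<close>.\<close>

definition M_relations :: "nat \<Rightarrow> (nat list \<times> nat list) set" where
  "M_relations n = {([1, n, i], [i + 1, n]) | i. 1 \<le> i \<and> i \<le> n - 1}"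

definition M_monoid :: "nat \<Rightarrow> nat list set monoid" where
  "M_monoid n = pres_monoid {1..n} (M_relations n)"

definition rho :: "nat \<Rightarrow> nat \<Rightarrow> nat list set" where
  "rho n i = pres_gen {1..n} (M_relations n) i"

definition words_for :: "nat \<Rightarrow> nat list set \<Rightarrow> nat list set" where
  "words_for n x = {w \<in> lists {1..n}. list_prod (M_monoid n) (map (rho n) w) = x}"

definition garside :: "nat \<Rightarrow> nat list set" where
  "garside n = rho n n [^]\<^bsub>M_monoid n\<^esub> (n + 1)"


section \<open>Schroeder trees\<close>

datatype ptree = Leaf | Node "ptree list"

primrec num_leaves :: "ptree \<Rightarrow> nat" where
  "num_leaves Leaf = 1"
| "num_leaves (Node ts) = sum_list (map num_leaves ts)"

text \<open>\<open>Node []\<close> would be a second encoding of the one-vertex tree; it is not a Schroeder tree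
  in the following sense.\<close>

inductive schroeder_tree :: "ptree \<Rightarrow> bool" where
  "schroeder_tree Leaf"
| "length ts \<ge> 2 \<Longrightarrow> (\<And>t. t \<in> set ts \<Longrightarrow> schroeder_tree t) \<Longrightarrow> schroeder_tree (Node ts)"

definition little_schroeder :: "nat \<Rightarrow> nat" where
  "little_schroeder k = card {t. schroeder_tree t \<and> num_leaves t = k}"

end

theory Submission
  imports Defs
begin

text \<open>Label the non-root vertices of a Schroeder tree by letters and read the labels in post-order:
  a vertex with \<open>k\<close> leaves below it gets \<open>n + 1 - k\<close>, unless it is the first child of its parent,
  in which case it gets the number of leaves below its siblings. Since
  \<open>(\<rho>\<^sub>1\<rho>\<^sub>n)\<^sup>j\<rho>\<^sub>i = \<rho>\<^sub>i\<^sub>+\<^sub>j\<rho>\<^sub>n\<^sup>j\<close>, a tree with \<open>k \<le> n + 1\<close> leaves yields a word for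
  \<open>(\<rho>\<^sub>1\<rho>\<^sub>n)\<^sup>k\<^sup>-\<^sup>1\<close>, and for \<open>k = n + 1\<close> this is the Garside element. The tree can be recovered
  from its word, since giving \<open>\<rho>\<^sub>i\<close> weight \<open>i\<close> determines where the block of the last child begins.
  Conversely, applying a defining relation to the word of a tree amounts to regrouping
  vertices of the tree, so every word for the Garside element arises from a tree.\<close>

section \<open>Words of trees\<close>

abbreviation leaves :: "ptree list \<Rightarrow> nat" where
  "leaves ts \<equiv> sum_list (map num_leaves ts)"

text \<open>The root gets no letter; a parent appends the letters of its children.
  \<open>Node []\<close> only gets a default value.\<close>

fun tree_word :: "nat \<Rightarrow> ptree \<Rightarrow> nat list" where
  "tree_word n Leaf = []"
| "tree_word n (Node []) = []"
| "tree_word n (Node (t # ts)) =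
    tree_word n t @ [leaves ts] @ concat (map (\<lambda>s. tree_word n s @ [n + 1 - num_leaves s]) ts)"

definition forest_word :: "nat \<Rightarrow> ptree list \<Rightarrow> nat list" where
  "forest_word n ts = concat (map (\<lambda>s. tree_word n s @ [n + 1 - num_leaves s]) ts)"

lemma forest_word_simps [simp]:
  "forest_word n [] = []"
  "forest_word n (t # ts) = tree_word n t @ [n + 1 - num_leaves t] @ forest_word n ts"
  "forest_word n (ts @ us) = forest_word n ts @ forest_word n us"
  by (simp_all add: forest_word_def)

lemma tree_word_Node [simp]:
  "tree_word n (Node (t # ts)) = tree_word n t @ [leaves ts] @ forest_word n ts"
  by (simp add: forest_word_def)

declare tree_word.simps(3) [simp del]

section \<open>Induction and leaf counts for Schroeder trees\<close>

lemma schroeder_tree_Node_Cons [simp]: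
  "schroeder_tree (Node (t # ts)) \<longleftrightarrow>
    schroeder_tree t \<and> ts \<noteq> [] \<and> (\<forall>s\<in>set ts. schroeder_tree s)"
  by (subst schroeder_tree.simps) (auto simp: Suc_le_eq)

lemma schroeder_tree_Leaf [simp]: "schroeder_tree Leaf"
  by (rule schroeder_tree.intros)

text \<open>The first child is kept apart because \<open>tree_word\<close> labels it differently
  from its siblings.\<close>

lemma schroeder_tree_induct [consumes 1, case_names Leaf Node]:
  assumes "schroeder_tree t"
    and "P Leaf"
    and "\<And>t ts. \<lbrakk>schroeder_tree t; ts \<noteq> []; \<And>s. s \<in> set ts \<Longrightarrow> schroeder_tree s; P t;
      \<And>s. s \<in> set ts \<Longrightarrow> P s\<rbrakk> \<Longrightarrow> P (Node (t # ts))"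
  shows "P t"
  using assms(1)
proof (induction rule: schroeder_tree.induct)
  case 1
  show ?case by fact
next
  case (2 ts)
  then obtain t us where "ts = t # us" "us \<noteq> []"
    by (cases ts; cases "tl ts") auto
  with 2 show ?case
    by (auto intro!: assms(3))
qed

lemma schroeder_tree_cases [consumes 1, case_names Leaf Node]:
  assumes "schroeder_tree t"
  obtains "t = Leaf"
  | x xs where "t = Node (x # xs)" "schroeder_tree x" "xs \<noteq> []"
      "\<And>s. s \<in> set xs \<Longrightarrow> schroeder_tree s"
  using assms
proof (induction rule: schroeder_tree_induct)
  case Leaf
  from Leaf(1)[OF HOL.refl] show thesis .
next
  case (Node t ts)
  from Node.prems(2)[OF HOL.refl Node.hyps] show thesis by blast
qed

lemma num_leaves_pos: "schroeder_tree t \<Longrightarrow> num_leaves t \<ge> 1"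
  by (induction rule: schroeder_tree_induct) auto

lemma leaves_pos:
  assumes "\<And>t. t \<in> set ts \<Longrightarrow> schroeder_tree t" "ts \<noteq> []"
  shows "leaves ts \<ge> 1"
proof (cases ts)
  case (Cons t us)
  with assms num_leaves_pos[of t] show ?thesis by simp
qed (use assms in simp)

lemma num_leaves_le_leaves: "t \<in> set ts \<Longrightarrow> num_leaves t \<le> leaves ts"
  by (simp add: member_le_sum_list)

lemma num_leaves_eq_1_iff:
  assumes "schroeder_tree t"
  shows "num_leaves t = 1 \<longleftrightarrow> t = Leaf"
  using assms
proof (cases rule: schroeder_tree_cases)
  case (Node x xs)
  with num_leaves_pos[of x] leaves_pos[of xs] show ?thesis by simp
qed simp

text \<open>The first letter belongs to the leftmost leaf and counts leaves other than that
  leaf.\<close>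

lemma tree_word_hd_less:
  assumes "schroeder_tree t" "tree_word n t = c # w"
  shows "c < num_leaves t"
  using assms
proof (induction arbitrary: w rule: schroeder_tree_induct)
  case (Node t ts)
  show ?case
  proof (cases "tree_word n t")
    case Nil
    with Node num_leaves_pos[of t] show ?thesis by auto
  next
    case (Cons c' w')
    with Node.prems Node.IH(1) show ?thesis by fastforce
  qed
qed auto

section \<open>Weights and unique parsing\<close>

text \<open>The block of a child with \<open>k\<close> leaves weighs
  \<open>(n + 1) * (k - 1) + (n + 1 - k) = n * k\<close>.\<close>

lemma sum_list_forest_word:
  assumes "\<And>t. t \<in> set ts \<Longrightarrow> schroeder_tree t" "leaves ts \<le> n + 1"
    and "\<And>t. t \<in> set ts \<Longrightarrow> sum_list (tree_word n t) + (n + 1) = (n + 1) * num_leaves t"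
  shows "sum_list (forest_word n ts) = n * leaves ts"
  using assms
proof (induction ts)
  case (Cons t ts)
  have block: "sum_list (tree_word n t) + (n + 1 - num_leaves t) = n * num_leaves t"
    using Cons.prems(2) Cons.prems(3)[of t] by simp
  have "sum_list (forest_word n ts) = n * leaves ts"
    using Cons by simp
  moreover have "sum_list (forest_word n (t # ts))
      = (sum_list (tree_word n t) + (n + 1 - num_leaves t)) + sum_list (forest_word n ts)"
    by simp
  ultimately show ?case
    unfolding block by (simp add: distrib_left)
qed simp

text \<open>For \<open>k\<close> and \<open>r\<close> leaves in the first child and its siblings,
  \<open>(n + 1) * (k - 1) + r + n * r = (n + 1) * (k + r - 1)\<close>.\<close>

lemma sum_list_tree_word:
  assumes "schroeder_tree t" "num_leaves t \<le> n + 1"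
  shows "sum_list (tree_word n t) + (n + 1) = (n + 1) * num_leaves t"
  using assms
proof (induction rule: schroeder_tree_induct)
  case (Node t ts)
  have "num_leaves s \<le> n + 1" if "s \<in> set ts" for s
    using num_leaves_le_leaves[OF that] Node.prems by simp
  then have "sum_list (forest_word n ts) = n * leaves ts"
    using Node by (intro sum_list_forest_word) auto
  with Node show ?case by (simp add: algebra_simps)
qed simp

text \<open>The first child and its siblings each own a leaf, so neither side has more than
  \<open>n\<close> of the at most \<open>n + 1\<close> leaves.\<close>

lemma tree_word_letters:
  assumes "schroeder_tree t" "num_leaves t \<le> n + 1"
  shows "tree_word n t \<in> lists {1..n}"
  using assms
proof (induction rule: schroeder_tree_induct)
  case (Node t ts)
  have "tree_word n s @ [n + 1 - num_leaves s] \<in> lists {1..n}" if "s \<in> set ts" for s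
    using num_leaves_le_leaves[OF that] num_leaves_pos[of t] num_leaves_pos[of s] that Node
    by auto
  then have "forest_word n ts \<in> lists {1..n}"
    by (fastforce simp: forest_word_def)
  with Node leaves_pos[of ts] num_leaves_pos[of t] show ?case by auto
qed simp

text \<open>One suffix contains the other; the overhang has weight zero, and positive letters make
  it empty.\<close>

lemma append_eq_append_sum_listD:
  fixes xs ys us vs :: "nat list"
  assumes "xs @ us = ys @ vs" "sum_list us = sum_list vs" "0 \<notin> set us" "0 \<notin> set vs"
  shows "xs = ys \<and> us = vs"
proof -
  have zero: "zs = []" if "sum_list zs = 0" "0 \<notin> set zs" for zs :: "nat list"
    using that by (cases zs) auto
  from assms(1) obtain zs where "xs = ys @ zs \<and> vs = zs @ us \<or> ys = xs @ zs \<and> us = zs @ vs"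
    by (auto simp: append_eq_append_conv2)
  with assms zero[of zs] show ?thesis by auto
qed

text \<open>A word is parsed from the right: its last letter gives the number of leaves, hence the
  weight of the block, of the last child. With \<open>r\<close> leaves split off in this way, the first child
  is reached as soon as the last letter is \<open>r\<close>; no later child can carry this label, because it
  would have \<open>n + 1 - r\<close> leaves.\<close>

lemma children_word_inj:
  assumes "tree_word n t @ [leaves ts + r] @ forest_word n ts
      = tree_word n t' @ [leaves ts' + r] @ forest_word n ts'"
    and "schroeder_tree t" "schroeder_tree t'"
    and "\<And>s. s \<in> set ts \<Longrightarrow> schroeder_tree s" "\<And>s. s \<in> set ts' \<Longrightarrow> schroeder_tree s"
    and "num_leaves t + leaves ts + r \<le> n + 1" "num_leaves t' + leaves ts' + r \<le> n + 1"
    and "\<And>s s'. \<lbrakk>s \<in> set (t # ts); schroeder_tree s'; num_leaves s' \<le> n + 1;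
      tree_word n s = tree_word n s'\<rbrakk> \<Longrightarrow> s = s'"
  shows "t = t' \<and> ts = ts'"
  using assms
proof (induction ts arbitrary: ts' r rule: rev_induct)
  case Nil
  show ?case
  proof (cases ts' rule: rev_cases)
    case Nil
    with Nil.prems show ?thesis by auto
  next
    case (snoc us u)
    with Nil.prems(1) have "r = n + 1 - num_leaves u" by simp
    moreover have "num_leaves t' + num_leaves u + r \<le> n + 1"
      using Nil.prems(7) snoc by simp
    ultimately show ?thesis
      using num_leaves_pos[OF Nil.prems(3)] by simp
  qed
next
  case (snoc x xs)
  show ?case
  proof (cases ts' rule: rev_cases)
    case Nil
    with snoc.prems(1) have "r = n + 1 - num_leaves x" by simp
    moreover have "num_leaves t + num_leaves x + r \<le> n + 1"
      using snoc.prems(6) by simp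
    ultimately show ?thesis
      using num_leaves_pos[OF snoc.prems(2)] by simp
  next
    case ts': (snoc us u)
    have sch: "schroeder_tree x" "schroeder_tree u"
      using snoc.prems(4)[of x] snoc.prems(5)[of u] ts' by simp_all
    \<comment> \<open>The first child owns a leaf; hence \<open>n + 1 - k\<close> is not truncated
      and determines \<open>k\<close>.\<close>
    have le: "num_leaves x \<le> n" "num_leaves u \<le> n"
      using snoc.prems(6,7) ts' num_leaves_pos[OF snoc.prems(2)] num_leaves_pos[OF snoc.prems(3)]
      by auto
    \<comment> \<open>Splitting off the last child moves its leaves into the offset
      \<open>r\<close>, so the letter of the first child is unchanged.\<close>
    let ?A = "tree_word n t @ [leaves xs + (num_leaves x + r)] @ forest_word n xs"
    let ?B = "tree_word n t' @ [leaves us + (num_leaves u + r)] @ forest_word n us"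
    have eq: "(?A @ tree_word n x) @ [n + 1 - num_leaves x]
        = (?B @ tree_word n u) @ [n + 1 - num_leaves u]"
      using snoc.prems(1) ts' by (simp add: add.assoc)
    then have xu: "num_leaves x = num_leaves u"
      using le by (simp only: append1_eq_conv) linarith
    have "?A @ tree_word n x = ?B @ tree_word n u"
      using eq by (simp only: append1_eq_conv)
    moreover have "sum_list (tree_word n x) = sum_list (tree_word n u)"
      using sum_list_tree_word[of x n] sum_list_tree_word[of u n] sch le xu by simp
    moreover have "0 \<notin> set (tree_word n x)" "0 \<notin> set (tree_word n u)"
      using tree_word_letters[of x n] tree_word_letters[of u n] sch le
      by (auto simp: in_lists_conv_set)
    ultimately have AB: "?A = ?B \<and> tree_word n x = tree_word n u"
      by (intro append_eq_append_sum_listD)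
    then have [simp]: "x = u"
      using snoc.prems(8)[of x u] sch le by simp
    have "t = t' \<and> xs = us"
    proof (rule snoc.IH[of "num_leaves u + r"])
      show "tree_word n t @ [leaves xs + (num_leaves u + r)] @ forest_word n xs
          = tree_word n t' @ [leaves us + (num_leaves u + r)] @ forest_word n us"
        using AB by simp
    next
      fix s s'
      assume "s \<in> set (t # xs)" "schroeder_tree s'" "num_leaves s' \<le> n + 1"
        "tree_word n s = tree_word n s'"
      then show "s = s'" by (intro snoc.prems(8)) auto
    qed (use snoc.prems(2-7) ts' in auto)
    then show ?thesis using ts' by simp
  qed
qed

lemma tree_word_inj:
  assumes "schroeder_tree t" "schroeder_tree t'" "num_leaves t \<le> n + 1" "num_leaves t' \<le> n + 1"
    and "tree_word n t = tree_word n t'"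
  shows "t = t'"
  using assms
proof (induction arbitrary: t' rule: schroeder_tree_induct)
  case Leaf
  show ?case
    using \<open>schroeder_tree t'\<close> Leaf.prems by (cases rule: schroeder_tree_cases) auto
next
  case (Node t ts)
  from \<open>schroeder_tree t'\<close> obtain x xs where t': "t' = Node (x # xs)"
    using Node.prems(4) by (cases rule: schroeder_tree_cases) auto
  have "t = x \<and> ts = xs"
  proof (rule children_word_inj[where r = 0])
    fix s s'
    assume "s \<in> set (t # ts)" "schroeder_tree s'" "num_leaves s' \<le> n + 1"
      "tree_word n s = tree_word n s'"
    moreover have "num_leaves s \<le> n + 1" if "s \<in> set (t # ts)"
      using num_leaves_le_leaves[OF that] Node.prems by simp
    ultimately show "s = s'" using Node.IH by auto
  qed (use Node.hyps Node.prems t' in auto)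
  with t' show ?case by simp
qed

section \<open>Tree words represent powers of \<open>\<rho>\<^sub>1\<rho>\<^sub>n\<close>\<close>

abbreviation M_cong :: "nat \<Rightarrow> (nat list \<times> nat list) set" where
  "M_cong n \<equiv> pres_cong {1..n} (M_relations n)"

definition first_last_power :: "nat \<Rightarrow> nat \<Rightarrow> nat list" where
  "first_last_power n k = concat (replicate k [1, n])"

lemma first_last_power_simps [simp]:
  "first_last_power n 0 = []"
  "first_last_power n (Suc k) = [1, n] @ first_last_power n k"
  by (simp_all add: first_last_power_def)

lemma first_last_power_Suc_right: "first_last_power n (Suc k) = first_last_power n k @ [1, n]"
  by (induction k) simp_all

text \<open>Each factor rho_1 rho_n raises the letter to its right by one and leaves a rho_n behind;
  \<open>i + k \<le> n\<close> keeps every step within the relations.\<close>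

lemma first_last_power_letter_cong:
  assumes "i \<ge> 1" "i + k \<le> n"
  shows "(first_last_power n k @ [i], [i + k] @ replicate k n) \<in> M_cong n"
  using assms
proof (induction k)
  case 0
  then show ?case by (auto intro: pres_cong.refl)
next
  case (Suc k)
  have "([1, n] @ (first_last_power n k @ [i]), [1, n] @ ([i + k] @ replicate k n)) \<in> M_cong n"
    using Suc by (intro pres_cong.append pres_cong.refl Suc.IH) auto
  moreover have "([1, n, i + k], [i + k + 1, n]) \<in> M_cong n"
    using Suc.prems by (intro pres_cong.rel) (auto simp: M_relations_def)
  then have "([1, n, i + k] @ replicate k n, [i + k + 1, n] @ replicate k n) \<in> M_cong n"
    using Suc.prems by (intro pres_cong.append pres_cong.refl) auto
  ultimately show ?case
    by (auto intro: pres_cong.trans)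
qed

text \<open>The last factor supplies the letter 1, which the other \<open>k - 1\<close> factors
  raise to \<open>k\<close>.\<close>

lemma first_last_power_cong:
  assumes "k \<le> n" "k \<ge> 1"
  shows "(first_last_power n k, [k] @ replicate k n) \<in> M_cong n"
proof -
  obtain j where k: "k = Suc j" using assms by (cases k) auto
  have "((first_last_power n j @ [1]) @ [n], ([1 + j] @ replicate j n) @ [n]) \<in> M_cong n"
    using assms k by (intro pres_cong.append pres_cong.refl first_last_power_letter_cong) auto
  then show ?thesis
    by (simp add: k first_last_power_Suc_right replicate_append_same del: first_last_power_simps(2))
qed

text \<open>A child with \<open>k\<close> leaves contributes (rho_1 rho_n)^(k-1) rho_(n+1-k) =
  rho_n^k.\<close>

lemma forest_word_cong:
  assumes "\<And>t. t \<in> set ts \<Longrightarrow> schroeder_tree t" "leaves ts \<le> n"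
    and "\<And>t. t \<in> set ts \<Longrightarrow> (tree_word n t, first_last_power n (num_leaves t - 1)) \<in> M_cong n"
  shows "(forest_word n ts, replicate (leaves ts) n) \<in> M_cong n"
  using assms
proof (induction ts)
  case Nil
  show ?case by (auto intro: pres_cong.refl)
next
  case (Cons t ts)
  have k: "num_leaves t \<ge> 1" "num_leaves t \<le> n"
    using num_leaves_pos Cons.prems by auto
  have "(tree_word n t @ [n + 1 - num_leaves t],
      first_last_power n (num_leaves t - 1) @ [n + 1 - num_leaves t]) \<in> M_cong n"
    using k Cons.prems by (intro pres_cong.append pres_cong.refl) auto
  moreover have "(first_last_power n (num_leaves t - 1) @ [n + 1 - num_leaves t],
      [n] @ replicate (num_leaves t - 1) n) \<in> M_cong n"
    using first_last_power_letter_cong[of "n + 1 - num_leaves t" "num_leaves t - 1" n] k by simp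
  moreover have "[n] @ replicate (num_leaves t - 1) n = replicate (num_leaves t) n"
    using k by (cases "num_leaves t") auto
  ultimately have "(tree_word n t @ [n + 1 - num_leaves t], replicate (num_leaves t) n) \<in> M_cong n"
    by (metis pres_cong.trans)
  then have "((tree_word n t @ [n + 1 - num_leaves t]) @ forest_word n ts,
      replicate (num_leaves t) n @ replicate (leaves ts) n) \<in> M_cong n"
    using Cons by (intro pres_cong.append Cons.IH) auto
  then show ?case by (simp add: replicate_add)
qed

text \<open>With k leaves in the first child and r in its siblings, (rho_1 rho_n)^(k-1) rho_r
  rho_n^r = rho_(k+r-1) rho_n^(k+r-1) = (rho_1 rho_n)^(k+r-1).\<close>

lemma tree_word_cong:
  assumes "schroeder_tree t" "num_leaves t \<le> n + 1"
  shows "(tree_word n t, first_last_power n (num_leaves t - 1)) \<in> M_cong n"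
  using assms
proof (induction rule: schroeder_tree_induct)
  case Leaf
  show ?case by (auto intro: pres_cong.refl)
next
  case (Node t ts)
  let ?k = "num_leaves t" and ?r = "leaves ts"
  have k: "?k \<ge> 1" "?r \<ge> 1" "?k + ?r \<le> n + 1"
    using num_leaves_pos leaves_pos Node by auto
  have "num_leaves s \<le> n + 1" if "s \<in> set ts" for s
    using num_leaves_le_leaves[OF that] k by simp
  then have "(forest_word n ts, replicate ?r n) \<in> M_cong n"
    using k Node by (intro forest_word_cong) auto
  then have "(tree_word n t @ [?r] @ forest_word n ts,
      first_last_power n (?k - 1) @ [?r] @ replicate ?r n) \<in> M_cong n"
    using k Node by (intro pres_cong.append pres_cong.refl) auto
  moreover have "((first_last_power n (?k - 1) @ [?r]) @ replicate ?r n,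
      ([?r + (?k - 1)] @ replicate (?k - 1) n) @ replicate ?r n) \<in> M_cong n"
    using k by (intro pres_cong.append pres_cong.refl first_last_power_letter_cong) auto
  moreover have "([?r + (?k - 1)] @ replicate (?k - 1) n) @ replicate ?r n
      = [?r + (?k - 1)] @ replicate (?r + (?k - 1)) n"
    by (simp add: replicate_add[symmetric] add.commute)
  moreover have "(first_last_power n (?r + (?k - 1)),
      [?r + (?k - 1)] @ replicate (?r + (?k - 1)) n) \<in> M_cong n"
    using k by (intro first_last_power_cong) auto
  moreover have "?r + (?k - 1) = num_leaves (Node (t # ts)) - 1"
    using k by simp
  ultimately show ?case
    by (metis (no_types, lifting) append_assoc pres_cong.sym pres_cong.trans tree_word_Node)
qed

section \<open>Tree words are closed under the relations\<close>

definition tree_words :: "nat \<Rightarrow> nat \<Rightarrow> nat list set" where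
  "tree_words n k = tree_word n ` {t. schroeder_tree t \<and> num_leaves t = k}"

definition forest_words :: "nat \<Rightarrow> nat \<Rightarrow> nat list set" where
  "forest_words n k = forest_word n ` {ts. (\<forall>t\<in>set ts. schroeder_tree t) \<and> leaves ts = k}"

lemma tree_wordsI: "schroeder_tree t \<Longrightarrow> num_leaves t = k \<Longrightarrow> tree_word n t \<in> tree_words n k"
  by (auto simp: tree_words_def)

lemma tree_wordsE:
  assumes "w \<in> tree_words n k"
  obtains t where "schroeder_tree t" "num_leaves t = k" "w = tree_word n t"
  using assms by (auto simp: tree_words_def)

lemma forest_wordsI:
  "(\<And>t. t \<in> set ts \<Longrightarrow> schroeder_tree t) \<Longrightarrow> leaves ts = k \<Longrightarrow> forest_word n ts \<in> forest_words n k"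
  by (auto simp: forest_words_def)

text \<open>Carries a rewriting inside one part to the whole tree, as the connecting letter depends
  only on the leaf count \<open>r\<close>. A positive \<open>r\<close> ensures siblings.\<close>

lemma tree_words_Node:
  assumes "w \<in> tree_words n k" "v \<in> forest_words n r" "r \<ge> 1"
  shows "w @ [r] @ v \<in> tree_words n (k + r)"
proof -
  from assms(1) obtain t where t: "schroeder_tree t" "num_leaves t = k" "w = tree_word n t"
    by (rule tree_wordsE)
  from assms(2) obtain ts where ts: "\<forall>t\<in>set ts. schroeder_tree t" "leaves ts = r" "v = forest_word n ts"
    by (auto simp: forest_words_def)
  from ts(2) \<open>r \<ge> 1\<close> have "ts \<noteq> []" by auto
  with t ts tree_wordsI[of "Node (t # ts)" "k + r" n] show ?thesis by simp
qed

lemma forest_words_Cons: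
  assumes "w \<in> tree_words n k" "v \<in> forest_words n r"
  shows "w @ [n + 1 - k] @ v \<in> forest_words n (k + r)"
proof -
  from assms obtain t ts where "schroeder_tree t" "num_leaves t = k" "w = tree_word n t"
    and "\<forall>t\<in>set ts. schroeder_tree t" "leaves ts = r" "v = forest_word n ts"
    by (auto simp: tree_words_def forest_words_def)
  with forest_wordsI[of "t # ts" "k + r" n] show ?thesis by auto
qed

text \<open>If the first tree had a nonempty word, \<open>tree_word_hd_less\<close> would give it
  more than \<open>n\<close> leaves. So \<open>n\<close> is its label, and it has one leaf.\<close>

lemma forest_word_eq_last_letter_Cons:
  assumes "\<And>s. s \<in> set ts \<Longrightarrow> schroeder_tree s" "leaves ts \<le> n" "forest_word n ts = n # v"
  obtains ts' where "ts = Leaf # ts'" "v = forest_word n ts'"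
proof -
  obtain t us where ts: "ts = t # us"
    using assms(3) by (cases ts) auto
  have "tree_word n t = []"
  proof (cases "tree_word n t")
    case (Cons c w)
    then have "n < num_leaves t"
      using tree_word_hd_less[of t n c w] assms ts by auto
    with assms(2) ts show ?thesis by simp
  qed
  then have "n + 1 - num_leaves t = n" "v = forest_word n us"
    using assms(3) ts by auto
  then have "num_leaves t = 1"
    using assms(2) ts num_leaves_pos[of t] assms(1) by auto
  with ts that num_leaves_eq_1_iff[of t] assms(1) \<open>v = forest_word n us\<close> show ?thesis by auto
qed

text \<open>The final \<open>n\<close> labels a last child that is a leaf. If the \<open>1\<close>
  before it labelled another later child, that child would have \<open>n\<close> leaves, giving at
  least \<open>n + 2\<close> together with the first and last children.\<close>

lemma tree_word_eq_append_first_last: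
  assumes "schroeder_tree t" "num_leaves t \<le> n + 1" "tree_word n t = u @ [1, n]"
  obtains x where "t = Node [x, Leaf]" "u = tree_word n x" "schroeder_tree x"
proof -
  obtain x ts where t: "t = Node (x # ts)"
    using assms(1,3) by (cases rule: schroeder_tree_cases) auto
  obtain us l where ts: "ts = us @ [l]"
    using assms(1) t by (cases ts rule: rev_cases) auto
  have x: "num_leaves x \<ge> 1" "schroeder_tree x" and l: "num_leaves l \<ge> 1" "schroeder_tree l"
    using num_leaves_pos assms(1) t ts by auto
  have "(tree_word n x @ [leaves ts] @ forest_word n us @ tree_word n l) @ [n + 1 - num_leaves l]
      = (u @ [1]) @ [n]"
    using assms(3) t ts by simp
  then have word: "tree_word n x @ [leaves ts] @ forest_word n us @ tree_word n l = u @ [1]"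
      "n + 1 - num_leaves l = n"
    by (simp_all only: append1_eq_conv)
  have "num_leaves l = 1"
    using word(2) l assms(2) t ts x by auto
  then have leaf: "l = Leaf"
    using num_leaves_eq_1_iff l by auto
  show ?thesis
  proof (cases us rule: rev_cases)
    case Nil
    with t ts leaf word that x show ?thesis by auto
  next
    case (snoc us' m)
    then have "(tree_word n x @ [leaves ts] @ forest_word n us' @ tree_word n m)
        @ [n + 1 - num_leaves m] = u @ [1]"
      using word(1) leaf by simp
    then have "n + 1 - num_leaves m = 1"
      by (simp only: append1_eq_conv)
    with snoc assms(2) t ts leaf x show ?thesis by auto
  qed
qed

text \<open>In the uses below, \<open>a\<close> is the letter after the word of a child. The cases:
  the factor before \<open>a\<close>, \<open>a\<close> as its second or first letter, the factor
  after \<open>a\<close>.\<close>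

lemma append_append_eq_append2:
  assumes "p @ a # q = u @ [x, y] @ v"
  obtains v' where "p = u @ [x, y] @ v'" "v = v' @ a # q"
  | "p = u @ [x]" "a = y" "v = q"
  | "p = u" "a = x" "q = y # v"
  | u' where "u = p @ a # u'" "q = u' @ [x, y] @ v"
  using assms
  by (auto simp: append_eq_append_conv2 append_eq_Cons_conv Cons_eq_append_conv)

lemma append_append_eq_append3:
  assumes "p @ a # q = u @ [x, y, z] @ v"
  obtains v' where "p = u @ [x, y, z] @ v'" "v = v' @ a # q"
  | "p = u @ [x, y]" "a = z" "v = q"
  | "p = u @ [x]" "a = y" "q = z # v"
  | "p = u" "a = x" "q = y # z # v"
  | u' where "u = p @ a # u'" "q = u' @ [x, y, z] @ v"
  using assms
  by (auto simp: append_eq_append_conv2 append_eq_Cons_conv Cons_eq_append_conv)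

text \<open>In both directions a relation acts on the tree by grouping a vertex \<open>x\<close> and its right
  sibling \<open>Leaf\<close> under a new vertex, or by the inverse operation.\<close>

lemma forest_words_group:
  assumes "forest_word n ts = u @ [i + 1, n] @ v" "1 \<le> i"
    and "\<And>s. s \<in> set ts \<Longrightarrow> schroeder_tree s" "leaves ts \<le> n"
    and "\<And>s u v. \<lbrakk>s \<in> set ts; tree_word n s = u @ [i + 1, n] @ v\<rbrakk>
      \<Longrightarrow> u @ [1, n, i] @ v \<in> tree_words n (num_leaves s)"
  shows "u @ [1, n, i] @ v \<in> forest_words n (leaves ts)"
  using assms
proof (induction ts arbitrary: u)
  case (Cons t ts)
  let ?k = "num_leaves t"
  have t: "schroeder_tree t" "?k \<ge> 1" "?k \<le> n" "leaves ts \<le> n"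
    using Cons.prems num_leaves_pos by auto
  have ts: "forest_word n ts \<in> forest_words n (leaves ts)"
    using Cons.prems by (intro forest_wordsI) auto
  have "tree_word n t @ (n + 1 - ?k) # forest_word n ts = u @ [i + 1, n] @ v"
    using Cons.prems(1) by simp
  then show ?case
  proof (cases rule: append_append_eq_append2)
    case (1 v')
    then have "u @ [1, n, i] @ v' \<in> tree_words n ?k"
      by (intro Cons.prems) auto
    from forest_words_Cons[OF this ts] 1 show ?thesis by simp
  next
    case 2
    \<comment> \<open>A label \<open>n\<close> belongs to a leaf, whose word is empty, yet it should
      end in \<open>i + 1\<close>.\<close>
    then have "?k = 1" using t by simp
    with t 2 num_leaves_eq_1_iff[of t] show ?thesis by auto
  next
    case 3
    then obtain ts' where ts': "ts = Leaf # ts'" "v = forest_word n ts'"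
      using forest_word_eq_last_letter_Cons[of ts n v] Cons.prems t by auto
    \<comment> \<open>\<open>Node [t, Leaf]\<close> reads \<open>1, n\<close> after the word of
      \<open>t\<close> and has the label \<open>n - ?k = i\<close>.\<close>
    have "forest_word n (Node [t, Leaf] # ts') \<in> forest_words n (leaves (t # ts))"
      using Cons.prems ts' by (intro forest_wordsI) auto
    moreover have "n - ?k = i" using 3 t by simp
    ultimately show ?thesis using 3 ts' by simp
  next
    case (4 u')
    then have "u' @ [1, n, i] @ v \<in> forest_words n (leaves ts)"
      using Cons.prems by (intro Cons.IH) auto
    from forest_words_Cons[OF tree_wordsI[OF t(1) HOL.refl] this] 4 show ?thesis by simp
  qed
qed simp

lemma tree_words_group:
  assumes "schroeder_tree t" "num_leaves t \<le> n + 1"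
    and "tree_word n t = u @ [i + 1, n] @ v" "1 \<le> i"
  shows "u @ [1, n, i] @ v \<in> tree_words n (num_leaves t)"
  using assms
proof (induction arbitrary: u v rule: schroeder_tree_induct)
  case (Node t ts)
  let ?k = "num_leaves t"
  have t: "?k \<ge> 1" "?k \<le> n + 1" "leaves ts \<le> n" "leaves ts \<ge> 1"
    using Node num_leaves_pos leaves_pos[of ts] by fastforce+
  have ts: "forest_word n ts \<in> forest_words n (leaves ts)"
    using Node by (intro forest_wordsI) auto
  have le: "num_leaves s \<le> n + 1" if "s \<in> set ts" for s
    using num_leaves_le_leaves[OF that] t by simp
  have "tree_word n t @ leaves ts # forest_word n ts = u @ [i + 1, n] @ v"
    using Node.prems(2) by simp
  then show ?case
  proof (cases rule: append_append_eq_append2)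
    case (1 v')
    then have "u @ [1, n, i] @ v' \<in> tree_words n ?k"
      using Node.IH(1) t Node.prems(3) by auto
    from tree_words_Node[OF this ts t(4)] 1 show ?thesis by simp
  next
    case 2
    then have "?k = 1" using t Node.prems by simp
    with Node 2 num_leaves_eq_1_iff[of t] show ?thesis by auto
  next
    case 3
    then obtain ts' where ts': "ts = Leaf # ts'" "v = forest_word n ts'"
      using forest_word_eq_last_letter_Cons[of ts n v] Node t by auto
    have "leaves ts' = i" using 3 ts' by simp
    \<comment> \<open>A positive \<open>i\<close> leaves a sibling, so the outer vertex keeps two
      children after the grouping.\<close>
    then have "ts' \<noteq> []" using Node.prems(3) by auto
    then have "tree_word n (Node (Node [t, Leaf] # ts')) \<in> tree_words n (num_leaves (Node (t # ts)))"
      using Node ts' by (intro tree_wordsI) auto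
    with 3 ts' \<open>leaves ts' = i\<close> show ?thesis by simp
  next
    case (4 u')
    then have "u' @ [1, n, i] @ v \<in> forest_words n (leaves ts)"
      using Node le t by (intro forest_words_group) auto
    from tree_words_Node[OF tree_wordsI[OF Node.hyps(1) HOL.refl] this t(4)] 4
    show ?thesis by simp
  qed
qed simp

lemma forest_words_ungroup:
  assumes "forest_word n ts = u @ [1, n, i] @ v"
    and "\<And>s. s \<in> set ts \<Longrightarrow> schroeder_tree s" "leaves ts \<le> n"
    and "\<And>s u v. \<lbrakk>s \<in> set ts; tree_word n s = u @ [1, n, i] @ v\<rbrakk>
      \<Longrightarrow> u @ [i + 1, n] @ v \<in> tree_words n (num_leaves s)"
  shows "u @ [i + 1, n] @ v \<in> forest_words n (leaves ts)"
  using assms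
proof (induction ts arbitrary: u)
  case (Cons t ts)
  let ?k = "num_leaves t"
  have t: "schroeder_tree t" "?k \<ge> 1" "?k \<le> n" "leaves ts \<le> n"
    using Cons.prems num_leaves_pos by auto
  have ts: "forest_word n ts \<in> forest_words n (leaves ts)"
    using Cons.prems by (intro forest_wordsI) auto
  have "tree_word n t @ (n + 1 - ?k) # forest_word n ts = u @ [1, n, i] @ v"
    using Cons.prems(1) by simp
  then show ?case
  proof (cases rule: append_append_eq_append3)
    case (1 v')
    then have "u @ [i + 1, n] @ v' \<in> tree_words n ?k"
      by (intro Cons.prems) auto
    from forest_words_Cons[OF this ts] 1 show ?thesis by simp
  next
    case 2
    then obtain x where x: "t = Node [x, Leaf]" "u = tree_word n x" "schroeder_tree x"
      using tree_word_eq_append_first_last[of t n u] t by auto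
    \<comment> \<open>As \<open>x\<close> has one leaf less than the dissolved vertex with label
      \<open>i\<close>, its new label is \<open>i + 1\<close>; the freed leaf reads
      \<open>n\<close>.\<close>
    have "forest_word n (x # Leaf # ts) \<in> forest_words n (leaves (t # ts))"
      using Cons.prems x by (intro forest_wordsI) auto
    moreover have "n + 1 - num_leaves x = i + 1" using 2 t x by simp
    ultimately show ?thesis using 2 x by simp
  next
    case 3
    then have "?k = 1" using t by simp
    with t 3 num_leaves_eq_1_iff[of t] show ?thesis by auto
  next
    case 4
    \<comment> \<open>A label 1 gives \<open>t\<close> all \<open>n\<close> leaves, so nothing can
      follow it, contrary to the letters \<open>n\<close> and \<open>i\<close>.\<close>
    have "?k + leaves ts \<le> n" using Cons.prems(3) by simp
    with 4 have "leaves ts = 0" by linarith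
    then have "ts = []"
      using leaves_pos[of ts] Cons.prems(2) by (metis list.set_intros(2) not_one_le_zero)
    with 4 show ?thesis by simp
  next
    case (5 u')
    then have "u' @ [i + 1, n] @ v \<in> forest_words n (leaves ts)"
      using Cons.prems by (intro Cons.IH) auto
    from forest_words_Cons[OF tree_wordsI[OF t(1) HOL.refl] this] 5 show ?thesis by simp
  qed
qed simp

lemma tree_words_ungroup:
  assumes "schroeder_tree t" "num_leaves t \<le> n + 1"
    and "tree_word n t = u @ [1, n, i] @ v"
  shows "u @ [i + 1, n] @ v \<in> tree_words n (num_leaves t)"
  using assms
proof (induction arbitrary: u v rule: schroeder_tree_induct)
  case (Node t ts)
  let ?k = "num_leaves t"
  have t: "?k \<ge> 1" "?k \<le> n + 1" "leaves ts \<le> n" "leaves ts \<ge> 1"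
    using Node num_leaves_pos leaves_pos[of ts] by fastforce+
  have ts: "forest_word n ts \<in> forest_words n (leaves ts)"
    using Node by (intro forest_wordsI) auto
  have le: "num_leaves s \<le> n + 1" if "s \<in> set ts" for s
    using num_leaves_le_leaves[OF that] t by simp
  have "tree_word n t @ leaves ts # forest_word n ts = u @ [1, n, i] @ v"
    using Node.prems(2) by simp
  then show ?case
  proof (cases rule: append_append_eq_append3)
    case (1 v')
    then have "u @ [i + 1, n] @ v' \<in> tree_words n ?k"
      using Node.IH(1) t by auto
    from tree_words_Node[OF this ts t(4)] 1 show ?thesis by simp
  next
    case 2
    then obtain x where x: "t = Node [x, Leaf]" "u = tree_word n x" "schroeder_tree x"
      using tree_word_eq_append_first_last[of t n u] Node t by auto
    \<comment> \<open>The freed leaf joins the siblings, so the first-child label becomes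
      \<open>leaves ts + 1 = i + 1\<close>.\<close>
    have "tree_word n (Node (x # Leaf # ts)) \<in> tree_words n (num_leaves (Node (t # ts)))"
      using Node x by (intro tree_wordsI) auto
    with 2 x show ?thesis by simp
  next
    case 3
    then have "?k = 1" using t Node.prems by simp
    with Node 3 num_leaves_eq_1_iff[of t] show ?thesis by auto
  next
    case 4
    \<comment> \<open>The label 1 allows a single leaf among the siblings, which accounts for
      \<open>n\<close>; nothing is left to yield \<open>i\<close>.\<close>
    then obtain ts' where ts': "ts = Leaf # ts'" "i # v = forest_word n ts'"
      using forest_word_eq_last_letter_Cons[of ts n "i # v"] Node t by auto
    with 4 have "leaves ts' = 0" by simp
    then have "ts' = []"
      using leaves_pos[of ts'] Node.hyps(3) ts'(1) by (metis list.set_intros(2) not_one_le_zero)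
    with ts' show ?thesis by simp
  next
    case (5 u')
    then have "u' @ [i + 1, n] @ v \<in> forest_words n (leaves ts)"
      using Node le t by (intro forest_words_ungroup) auto
    from tree_words_Node[OF tree_wordsI[OF Node.hyps(1) HOL.refl] this t(4)] 5
    show ?thesis by simp
  qed
qed simp

text \<open>Arbitrary contexts \<open>p\<close> and \<open>s\<close> turn \<open>append\<close> into
  two successive replacements, and the equivalence covers \<open>sym\<close>. For
  \<open>rel\<close>, the directions are ungrouping and grouping.\<close>

lemma tree_words_cong:
  assumes "(u, v) \<in> M_cong n" "k \<le> n + 1"
  shows "p @ u @ s \<in> tree_words n k \<longleftrightarrow> p @ v @ s \<in> tree_words n k"
  using assms(1)
proof (induction arbitrary: p s rule: pres_cong.induct)
  case (rel u v)
  then obtain i where i: "1 \<le> i" "u = [1, n, i]" "v = [i + 1, n]"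
    by (auto simp: M_relations_def)
  show ?case
  proof
    assume "p @ u @ s \<in> tree_words n k"
    then obtain t where "schroeder_tree t" "num_leaves t = k" "p @ u @ s = tree_word n t"
      by (rule tree_wordsE)
    with tree_words_ungroup[of t n p i s] assms(2) i(2,3) show "p @ v @ s \<in> tree_words n k"
      by simp
  next
    assume "p @ v @ s \<in> tree_words n k"
    then obtain t where "schroeder_tree t" "num_leaves t = k" "p @ v @ s = tree_word n t"
      by (rule tree_wordsE)
    with tree_words_group[of t n p i s] assms(2) i show "p @ u @ s \<in> tree_words n k"
      by simp
  qed
next
  case (trans u v w)
  then show ?case by blast
next
  case (append u v u' v')
  have "p @ (u @ u') @ s \<in> tree_words n k \<longleftrightarrow> p @ v @ (u' @ s) \<in> tree_words n k"
    using append.IH(1)[of p "u' @ s"] by simp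
  also have "\<dots> \<longleftrightarrow> p @ (v @ v') @ s \<in> tree_words n k"
    using append.IH(2)[of "p @ v" s] by simp
  finally show ?case .
qed auto

section \<open>The Garside element\<close>

lemma garside_eq_class:
  assumes "n \<ge> 1"
  shows "garside n = M_cong n `` {replicate (n + 1) n}"
proof -
  have rep: "replicate m n \<in> lists {1..n}" for m
    using assms by auto
  have "rho n n [^]\<^bsub>M_monoid n\<^esub> m = M_cong n `` {replicate m n}" for m :: nat
  proof (induction m)
    case 0
    show ?case by (simp add: M_monoid_def pres_monoid_def nat_pow_def)
  next
    case (Suc m)
    have "rho n n [^]\<^bsub>M_monoid n\<^esub> Suc m
        = (rho n n [^]\<^bsub>M_monoid n\<^esub> m) \<otimes>\<^bsub>M_monoid n\<^esub> rho n n"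
      by (simp add: nat_pow_def)
    also have "\<dots> = M_cong n `` {replicate m n @ [n]}"
      unfolding Suc unfolding rho_def pres_gen_def M_monoid_def
      using assms rep by (intro pres_mult_class) auto
    finally show ?case by (simp add: replicate_append_same)
  qed
  then show ?thesis by (simp only: garside_def)
qed

lemma words_for_garside:
  assumes "n \<ge> 1"
  shows "words_for n (garside n) = tree_words n (n + 1)"
proof -
  let ?g = "replicate (n + 1) n"
  have g: "?g \<in> lists {1..n}"
    using assms by auto
  have "words_for n (garside n) = {w \<in> lists {1..n}. M_cong n `` {w} = M_cong n `` {?g}}"
    unfolding words_for_def M_monoid_def rho_def garside_eq_class[OF assms]
    by (intro Collect_cong conj_cong HOL.refl) (simp only: list_prod_pres_gen)
  also have "\<dots> = {w. (w, ?g) \<in> M_cong n}"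
    using eq_equiv_class_iff[OF equiv_pres_cong _ g] pres_cong_lists by blast
  also have "\<dots> = tree_words n (n + 1)"
  proof (intro equalityI subsetI CollectI)
    have "(first_last_power n n, ?g) \<in> M_cong n"
      using first_last_power_cong[of n n] assms by simp
    moreover fix w
    assume "w \<in> tree_words n (n + 1)"
    then obtain t where "schroeder_tree t" "num_leaves t = n + 1" "w = tree_word n t"
      by (rule tree_wordsE)
    with tree_word_cong[of t n] have "(w, first_last_power n n) \<in> M_cong n"
      by simp
    ultimately show "(w, ?g) \<in> M_cong n"
      by (rule pres_cong.trans[rotated])
  next
    \<comment> \<open>The corolla yields rho_n^(n+1): its first child counts \<open>n\<close>
      sibling leaves, and every other leaf has label \<open>n\<close>.\<close>
    have "tree_word n (Node (replicate (n + 1) Leaf)) \<in> tree_words n (n + 1)"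
      using assms by (intro tree_wordsI) (auto simp: sum_list_replicate)
    moreover have "forest_word n (replicate m Leaf) = replicate m n" for m
      by (induction m) auto
    ultimately have "?g \<in> tree_words n (n + 1)"
      by (simp add: sum_list_replicate)
    moreover fix w
    assume "w \<in> {w. (w, ?g) \<in> M_cong n}"
    ultimately show "w \<in> tree_words n (n + 1)"
      using tree_words_cong[of w ?g n "n + 1" "[]" "[]"] by simp
  qed
  finally show ?thesis .
qed

text \<open>All these words have weight \<open>(n + 1) * n\<close>, which bounds their length since
  letters are positive.\<close>

lemma finite_tree_words: "finite (tree_words n (n + 1))"
proof (rule finite_subset)
  have length_le: "length w \<le> sum_list w" if "w \<in> lists {1..n}" for w
    using that by (induction w) auto
  show "tree_words n (n + 1) \<subseteq> {w. set w \<subseteq> {1..n} \<and> length w \<le> (n + 1) * n}"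
  proof
    fix w
    assume "w \<in> tree_words n (n + 1)"
    then obtain t where t: "schroeder_tree t" "num_leaves t = n + 1" "w = tree_word n t"
      by (rule tree_wordsE)
    then have "w \<in> lists {1..n}" "sum_list w = (n + 1) * n"
      using tree_word_letters[of t n] sum_list_tree_word[of t n] by simp_all
    with length_le[of w] show "w \<in> {w. set w \<subseteq> {1..n} \<and> length w \<le> (n + 1) * n}"
      by (auto simp: in_lists_conv_set)
  qed
qed (simp add: finite_lists_length_le)

theorem corollary3p14:
  fixes n :: nat
  assumes "n \<ge> 1"
  shows "finite (words_for n (garside n)) \<and>
    card (words_for n (garside n)) = little_schroeder (n + 1)"
proof -
  have "inj_on (tree_word n) {t. schroeder_tree t \<and> num_leaves t = n + 1}"
    by (auto intro!: inj_onI tree_word_inj[where n = n])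
  then have "card (tree_words n (n + 1)) = little_schroeder (n + 1)"
    by (simp add: tree_words_def little_schroeder_def card_image)
  with words_for_garside[OF assms] finite_tree_words show ?thesis by simp
qed

end
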